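(* Let $G$ be an $\aleph_0$-saturated group. Then the Fitting subgroup $F(G)$ is definable if and only if $F(G)$ is uniformly normally locally nilpotent. Similarly, the soluble radical $R(G)$ is definable if and only if $R(G)$ is uniformly normally locally soluble.
   Context: For an arbitrary group $G$, the Fitting subgroup $F(G)$ is the subgroup generated by all normal nilpotent subgroups of $G$, and the soluble radical $R(G)$ is the subgroup generated by all normal soluble subgroups of $G$. Groups are viewed as first-order structures in the language of groups. A subset of $G$ is definable if it is the set of solutions in $G$ of a first-order formula in the language of groups, possibly with parameters from $G$. $G$ is $\aleph_0$-saturated if every type over a finite subset of $G$ (in finitely many variables) is realized in $G$. $F(G)$ is uniformly normally locally nilpotent if for every positive integer $m$ there exists an integer $d(m)$ such that for every finite subset $A\subseteq F(G)$ of cardinality at most $m$, the normal closure of $A$ in $G$ is nilpotent of class at most $d(m)$. $R(G)$ is uniformly normally locally soluble if for every positive integer $m$ there exists an integer $d(m)$ such that for every finite subset $A\subseteq R(G)$ of cardinality at most $m$, the normal closure of $A$ in $G$ is soluble of derived length at most $d(m)$. *)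

theory Defs
  imports "HOL-Algebra.Solvable_Groups"
begin

section \<open>First-order formulas over a group\<close>

text \<open>
  Terms and formulas of the language of groups (multiplication, inverse, neutral element),
  expanded by a constant \<open>Param a\<close> for every element \<open>a\<close> that may serve as a parameter.
  The set functions \<open>tparams\<close> and \<open>params\<close> of the two datatypes give the parameters that occur.
\<close>

datatype (tparams: 'a) gterm =
    Var nat
  | Param 'a
  | Neutral
  | Mult "'a gterm" "'a gterm"
  | Inv "'a gterm"

datatype (params: 'a) gform =
    Eq "'a gterm" "'a gterm"
  | Neg "'a gform"
  | And "'a gform" "'a gform"
  | Ex nat "'a gform"

primrec tvars :: "'a gterm \<Rightarrow> nat set" where
  "tvars (Var i) = {i}"
| "tvars (Param a) = {}"
| "tvars Neutral = {}"
| "tvars (Mult s t) = tvars s \<union> tvars t"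
| "tvars (Inv t) = tvars t"

primrec free_vars :: "'a gform \<Rightarrow> nat set" where
  "free_vars (Eq s t) = tvars s \<union> tvars t"
| "free_vars (Neg \<phi>) = free_vars \<phi>"
| "free_vars (And \<phi> \<psi>) = free_vars \<phi> \<union> free_vars \<psi>"
| "free_vars (Ex i \<phi>) = free_vars \<phi> - {i}"

primrec tval :: "('a, 'b) monoid_scheme \<Rightarrow> (nat \<Rightarrow> 'a) \<Rightarrow> 'a gterm \<Rightarrow> 'a" where
  "tval G e (Var i) = e i"
| "tval G e (Param a) = a"
| "tval G e Neutral = \<one>\<^bsub>G\<^esub>"
| "tval G e (Mult s t) = tval G e s \<otimes>\<^bsub>G\<^esub> tval G e t"
| "tval G e (Inv t) = inv\<^bsub>G\<^esub> (tval G e t)"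

primrec sat :: "('a, 'b) monoid_scheme \<Rightarrow> (nat \<Rightarrow> 'a) \<Rightarrow> 'a gform \<Rightarrow> bool" where
  "sat G e (Eq s t) \<longleftrightarrow> tval G e s = tval G e t"
| "sat G e (Neg \<phi>) \<longleftrightarrow> \<not> sat G e \<phi>"
| "sat G e (And \<phi> \<psi>) \<longleftrightarrow> sat G e \<phi> \<and> sat G e \<psi>"
| "sat G e (Ex i \<phi>) \<longleftrightarrow> (\<exists>a\<in>carrier G. sat G (e(i := a)) \<phi>)"

text \<open>The formulas with free variables among the first \<open>n\<close> ones and parameters from \<open>A\<close>.\<close>

definition formulas_over :: "'a set \<Rightarrow> nat \<Rightarrow> 'a gform set" where
  "formulas_over A n = {\<phi>. free_vars \<phi> \<subseteq> {..<n} \<and> params \<phi> \<subseteq> A}"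

text \<open>The only free variable allowed below is \<open>Var 0\<close>, so the rest of the assignment is irrelevant.\<close>

definition definable :: "('a, 'b) monoid_scheme \<Rightarrow> 'a set \<Rightarrow> bool" where
  "definable G S \<longleftrightarrow>
     (\<exists>\<phi> \<in> formulas_over (carrier G) 1. S = {a \<in> carrier G. sat G (\<lambda>_. a) \<phi>})"


section \<open>Types and saturation\<close>

text \<open>An \<open>n\<close>-tuple is given by the values of \<open>e\<close> on \<open>{..<n}\<close>.\<close>

definition realizes :: "('a, 'b) monoid_scheme \<Rightarrow> nat \<Rightarrow> (nat \<Rightarrow> 'a) \<Rightarrow> 'a gform set \<Rightarrow> bool" where
  "realizes G n e p \<longleftrightarrow> (\<forall>i<n. e i \<in> carrier G) \<and> (\<forall>\<phi>\<in>p. sat G e \<phi>)"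

text \<open>
  An \<open>n\<close>-type of \<open>G\<close> over \<open>A\<close> is a complete one: a set of formulas over \<open>A\<close> that is finitely
  satisfiable in \<open>G\<close> (equivalently, by compactness, consistent with the elementary diagram of \<open>G\<close>)
  and that decides every formula over \<open>A\<close>.  Since every finitely satisfiable set extends to a
  complete one, \<open>aleph0_saturated\<close> does not depend on whether partial types are admitted.
\<close>

definition is_type :: "('a, 'b) monoid_scheme \<Rightarrow> 'a set \<Rightarrow> nat \<Rightarrow> 'a gform set \<Rightarrow> bool" where
  "is_type G A n p \<longleftrightarrow>
     p \<subseteq> formulas_over A n \<and>
     (\<forall>q\<subseteq>p. finite q \<longrightarrow> (\<exists>e. realizes G n e q)) \<and>
     (\<forall>\<phi> \<in> formulas_over A n. \<phi> \<in> p \<or> Neg \<phi> \<in> p)"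

definition aleph0_saturated :: "('a, 'b) monoid_scheme \<Rightarrow> bool" where
  "aleph0_saturated G \<longleftrightarrow>
     (\<forall>A n p. finite A \<and> A \<subseteq> carrier G \<and> is_type G A n p \<longrightarrow> (\<exists>e. realizes G n e p))"


section \<open>Nilpotency class and derived length\<close>

definition commutator_subgroup :: "('a, 'b) monoid_scheme \<Rightarrow> 'a set \<Rightarrow> 'a set \<Rightarrow> 'a set" where
  "commutator_subgroup G H K =
     generate G {h \<otimes>\<^bsub>G\<^esub> k \<otimes>\<^bsub>G\<^esub> inv\<^bsub>G\<^esub> h \<otimes>\<^bsub>G\<^esub> inv\<^bsub>G\<^esub> k | h k. h \<in> H \<and> k \<in> K}"

text \<open>The index is shifted: \<open>lower_central G n\<close> is the term usually written \<open>\<gamma>\<close> with index \<open>n + 1\<close>.\<close>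

primrec lower_central :: "('a, 'b) monoid_scheme \<Rightarrow> nat \<Rightarrow> 'a set" where
  "lower_central G 0 = carrier G"
| "lower_central G (Suc n) = commutator_subgroup G (lower_central G n) (carrier G)"

definition nilpotent_class_le :: "('a, 'b) monoid_scheme \<Rightarrow> nat \<Rightarrow> bool" where
  "nilpotent_class_le G d \<longleftrightarrow> lower_central G d = {\<one>\<^bsub>G\<^esub>}"

definition nilpotent :: "('a, 'b) monoid_scheme \<Rightarrow> bool" where
  "nilpotent G \<longleftrightarrow> (\<exists>d. nilpotent_class_le G d)"

definition derived_length_le :: "('a, 'b) monoid_scheme \<Rightarrow> nat \<Rightarrow> bool" where
  "derived_length_le G d \<longleftrightarrow> (derived G ^^ d) (carrier G) = {\<one>\<^bsub>G\<^esub>}"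


section \<open>Fitting subgroup and soluble radical\<close>

definition fitting :: "('a, 'b) monoid_scheme \<Rightarrow> 'a set" where
  "fitting G = generate G (\<Union>{N. N \<lhd> G \<and> nilpotent (G\<lparr>carrier := N\<rparr>)})"

definition soluble_radical :: "('a, 'b) monoid_scheme \<Rightarrow> 'a set" where
  "soluble_radical G = generate G (\<Union>{N. N \<lhd> G \<and> solvable (G\<lparr>carrier := N\<rparr>)})"

definition normal_closure :: "('a, 'b) monoid_scheme \<Rightarrow> 'a set \<Rightarrow> 'a set" where
  "normal_closure G A = \<Inter>{N. N \<lhd> G \<and> A \<subseteq> N}"

definition fitting_uniformly_normally_locally_nilpotent :: "('a, 'b) monoid_scheme \<Rightarrow> bool" where
  "fitting_uniformly_normally_locally_nilpotent G \<longleftrightarrow>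
     (\<forall>m>0. \<exists>d. \<forall>A. finite A \<and> card A \<le> m \<and> A \<subseteq> fitting G \<longrightarrow>
        nilpotent_class_le (G\<lparr>carrier := normal_closure G A\<rparr>) d)"

definition radical_uniformly_normally_locally_soluble :: "('a, 'b) monoid_scheme \<Rightarrow> bool" where
  "radical_uniformly_normally_locally_soluble G \<longleftrightarrow>
     (\<forall>m>0. \<exists>d. \<forall>A. finite A \<and> card A \<le> m \<and> A \<subseteq> soluble_radical G \<longrightarrow>
        derived_length_le (G\<lparr>carrier := normal_closure G A\<rparr>) d)"

end

theory Submission
  imports Defs
begin

text \<open>
  If \<open>X\<close> and \<open>Y\<close> are closed under conjugation, then the commutator subgroup of the subgroups they
  generate is generated by the commutators \<open>[x, y]\<close> alone, and these again form a set closed under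
  conjugation.  Hence the lower central and the derived series of the normal closure of \<open>x\<close> are
  generated by iterated commutators of conjugates of \<open>x\<close>, and "the normal closure of \<open>x\<close> has class
  (derived length) at most \<open>d\<close>" is a first-order condition on \<open>x\<close>.  The radical is the increasing
  union over \<open>d\<close> of the sets defined by these conditions.  If it is definable, saturation forces the
  union to stop at a finite stage \<open>d\<close>, and then the normal closure of \<open>m\<close> elements, being a product
  of \<open>m\<close> normal subgroups of class (derived length) at most \<open>d\<close>, has class (derived length) at
  most \<open>m * d\<close>.  Conversely, the uniform bound for \<open>m = 1\<close> says that the union stops.
\<close>

section \<open>Saturation and partial types\<close>

lemma tval_cong:
  "(\<And>i. i \<in> tvars t \<Longrightarrow> e i = e' i) \<Longrightarrow> tval G e t = tval G e' t"
  by (induction t) auto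

lemma sat_cong:
  "(\<And>i. i \<in> free_vars \<phi> \<Longrightarrow> e i = e' i) \<Longrightarrow> sat G e \<phi> = sat G e' \<phi>"
proof (induction \<phi> arbitrary: e e')
  case (Eq s t)
  then have "tval G e s = tval G e' s" "tval G e t = tval G e' t"
    by (auto intro: tval_cong)
  then show ?case by simp
next
  case (Neg \<phi>)
  have "sat G e \<phi> = sat G e' \<phi>"
    using Neg.prems by (intro Neg.IH) simp
  then show ?case by simp
next
  case (And \<phi> \<psi>)
  have "sat G e \<phi> = sat G e' \<phi>" "sat G e \<psi> = sat G e' \<psi>"
    using And.prems by (auto intro!: And.IH)
  then show ?case by simp
next
  case (Ex i \<phi>)
  have "sat G (e(i := a)) \<phi> = sat G (e'(i := a)) \<phi>" for a
    using Ex.prems by (intro Ex.IH) auto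
  then show ?case by simp
qed

definition finitely_satisfiable :: "('a, 'b) monoid_scheme \<Rightarrow> nat \<Rightarrow> 'a gform set \<Rightarrow> bool" where
  "finitely_satisfiable G n p \<longleftrightarrow> (\<forall>q\<subseteq>p. finite q \<longrightarrow> (\<exists>e. realizes G n e q))"

text \<open>If a finite \<open>q\<close> refutes the side of \<open>Neg \<phi>\<close>, then every
  realization of \<open>q - {Neg \<phi>}\<close> satisfies \<open>\<phi>\<close>. Adding this
  remainder to a finite part of \<open>p\<close> therefore yields realizations that satisfy
  \<open>\<phi>\<close> as well.\<close>

lemma finitely_satisfiable_insert:
  assumes p: "finitely_satisfiable G n p"
  shows "finitely_satisfiable G n (insert \<phi> p) \<or> finitely_satisfiable G n (insert (Neg \<phi>) p)"
proof (rule disjCI)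
  assume "\<not> finitely_satisfiable G n (insert (Neg \<phi>) p)"
  then obtain q where q: "q \<subseteq> insert (Neg \<phi>) p" "finite q" "\<And>e. \<not> realizes G n e q"
    unfolding finitely_satisfiable_def by blast
  show "finitely_satisfiable G n (insert \<phi> p)"
    unfolding finitely_satisfiable_def
  proof (intro allI impI)
    fix r assume r: "r \<subseteq> insert \<phi> p" "finite r"
    have "(q - {Neg \<phi>}) \<union> (r - {\<phi>}) \<subseteq> p" "finite ((q - {Neg \<phi>}) \<union> (r - {\<phi>}))"
      using q r by auto
    then obtain e where e: "realizes G n e ((q - {Neg \<phi>}) \<union> (r - {\<phi>}))"
      using p unfolding finitely_satisfiable_def by meson
    moreover have "sat G e \<phi>"
    proof (rule ccontr)
      assume n\<phi>: "\<not> sat G e \<phi>"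
      have "sat G e \<theta>" if "\<theta> \<in> q" for \<theta>
        using that e n\<phi> by (cases "\<theta> = Neg \<phi>") (auto simp: realizes_def)
      then have "realizes G n e q" using e by (simp add: realizes_def)
      then show False using q(3) by blast
    qed
    ultimately have "sat G e \<theta>" if "\<theta> \<in> r" for \<theta>
      using that by (cases "\<theta> = \<phi>") (auto simp: realizes_def)
    then have "realizes G n e r" using e by (simp add: realizes_def)
    then show "\<exists>e. realizes G n e r" by (rule exI[of _ e])
  qed
qed

text \<open>Lindenbaum's argument: Zorn's lemma gives a maximal finitely satisfiable superset over
  the same parameters, and by \<open>finitely_satisfiable_insert\<close> maximality forces it to
  decide every formula.\<close>

lemma finitely_satisfiable_extends_to_type:
  assumes "p \<subseteq> formulas_over A n" and "finitely_satisfiable G n p"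
  obtains p' where "p \<subseteq> p'" and "is_type G A n p'"
proof -
  let ?S = "{r. p \<subseteq> r \<and> r \<subseteq> formulas_over A n \<and> finitely_satisfiable G n r}"
  have "\<exists>M\<in>?S. \<forall>X\<in>?S. M \<subseteq> X \<longrightarrow> X = M"
  proof (rule subset_Zorn_nonempty)
    show "?S \<noteq> {}" using assms by blast
    fix C assume C: "C \<noteq> {}" "subset.chain ?S C"
    then have CS: "C \<subseteq> ?S" by (simp add: subset.chain_def)
    have "finitely_satisfiable G n (\<Union>C)"
      unfolding finitely_satisfiable_def
    proof (intro allI impI)
      \<comment> \<open>A finite part of the union of a chain already lies in one member of the
        chain.\<close>
      fix q assume "q \<subseteq> \<Union>C" "finite q"
      then obtain B where "B \<in> C" "q \<subseteq> B"
        using finite_subset_Union_chain[OF _ _ C] by blast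
      then show "\<exists>e. realizes G n e q"
        using CS \<open>finite q\<close> unfolding finitely_satisfiable_def by blast
    qed
    then show "\<Union>C \<in> ?S" using CS C(1) by blast
  qed
  then obtain M where MS: "M \<in> ?S" and max: "\<forall>X\<in>?S. M \<subseteq> X \<longrightarrow> X = M" by (rule bexE)
  from MS have M: "p \<subseteq> M" "M \<subseteq> formulas_over A n" "finitely_satisfiable G n M" by simp_all
  have "\<phi> \<in> M \<or> Neg \<phi> \<in> M" if \<phi>: "\<phi> \<in> formulas_over A n" for \<phi>
  proof -
    have neg: "Neg \<phi> \<in> formulas_over A n" using \<phi> by (simp add: formulas_over_def)
    have "\<psi> \<in> M" if "finitely_satisfiable G n (insert \<psi> M)" "\<psi> \<in> {\<phi>, Neg \<phi>}" for \<psi>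
    proof -
      have "insert \<psi> M \<in> ?S" using that neg \<phi> M by auto
      then have "insert \<psi> M = M" using max by (meson subset_insertI)
      then show ?thesis by blast
    qed
    then show ?thesis using finitely_satisfiable_insert[OF M(3), of \<phi>] by blast
  qed
  then have "is_type G A n M"
    using M unfolding is_type_def finitely_satisfiable_def by blast
  then show thesis using that M by blast
qed

text \<open>Saturation is stated for complete types, but the set of formulas to be realized later is
  only a partial one.\<close>

lemma aleph0_saturated_realizes:
  assumes "aleph0_saturated G" "finite A" "A \<subseteq> carrier G"
    and "p \<subseteq> formulas_over A n" "finitely_satisfiable G n p"
  shows "\<exists>e. realizes G n e p"
proof -
  obtain p' where "p \<subseteq> p'" "is_type G A n p'"
    using finitely_satisfiable_extends_to_type[OF assms(4,5)] by blast
  moreover from this obtain e where "realizes G n e p'"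
    using assms unfolding aleph0_saturated_def by blast
  ultimately show ?thesis unfolding realizes_def by blast
qed

section \<open>Commutators of conjugation-closed sets\<close>

definition conj_closed :: "('a, 'b) monoid_scheme \<Rightarrow> 'a set \<Rightarrow> bool" where
  "conj_closed G X \<longleftrightarrow> X \<subseteq> carrier G \<and>
     (\<forall>x\<in>X. \<forall>g\<in>carrier G. g \<otimes>\<^bsub>G\<^esub> x \<otimes>\<^bsub>G\<^esub> inv\<^bsub>G\<^esub> g \<in> X)"

definition commutators :: "('a, 'b) monoid_scheme \<Rightarrow> 'a set \<Rightarrow> 'a set \<Rightarrow> 'a set" where
  "commutators G X Y =
     {h \<otimes>\<^bsub>G\<^esub> k \<otimes>\<^bsub>G\<^esub> inv\<^bsub>G\<^esub> h \<otimes>\<^bsub>G\<^esub> inv\<^bsub>G\<^esub> k | h k. h \<in> X \<and> k \<in> Y}"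

text \<open>These are sets of commutators, not the subgroups they generate. Thus for fixed
  \<open>n\<close> each element is built from a bounded number of elements of \<open>X\<close>,
  which a single formula can express.\<close>

primrec left_commutators :: "('a, 'b) monoid_scheme \<Rightarrow> 'a set \<Rightarrow> nat \<Rightarrow> 'a set" where
  "left_commutators G X 0 = X"
| "left_commutators G X (Suc n) = commutators G (left_commutators G X n) X"

primrec derived_commutators :: "('a, 'b) monoid_scheme \<Rightarrow> 'a set \<Rightarrow> nat \<Rightarrow> 'a set" where
  "derived_commutators G X 0 = X"
| "derived_commutators G X (Suc n) =
     commutators G (derived_commutators G X n) (derived_commutators G X n)"

lemma commutator_subgroup_commutators:
  "commutator_subgroup G H K = generate G (commutators G H K)"
  by (simp add: commutator_subgroup_def commutators_def)

lemma derived_commutator_subgroup: "derived G H = commutator_subgroup G H H"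
proof -
  have "derived_set G H = commutators G H H" unfolding commutators_def by blast
  then show ?thesis by (simp add: derived_def commutator_subgroup_commutators)
qed

lemma commutatorsI:
  "h \<in> X \<Longrightarrow> k \<in> Y \<Longrightarrow> h \<otimes>\<^bsub>G\<^esub> k \<otimes>\<^bsub>G\<^esub> inv\<^bsub>G\<^esub> h \<otimes>\<^bsub>G\<^esub> inv\<^bsub>G\<^esub> k \<in> commutators G X Y"
  unfolding commutators_def by blast

lemma commutatorsE:
  assumes "c \<in> commutators G X Y"
  obtains h k where "h \<in> X" "k \<in> Y" "c = h \<otimes>\<^bsub>G\<^esub> k \<otimes>\<^bsub>G\<^esub> inv\<^bsub>G\<^esub> h \<otimes>\<^bsub>G\<^esub> inv\<^bsub>G\<^esub> k"
  using assms unfolding commutators_def by blast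

lemma commutators_mono: "X \<subseteq> X' \<Longrightarrow> Y \<subseteq> Y' \<Longrightarrow> commutators G X Y \<subseteq> commutators G X' Y'"
  unfolding commutators_def by blast

lemma left_commutators_mono: "X \<subseteq> Y \<Longrightarrow> left_commutators G X n \<subseteq> left_commutators G Y n"
  by (induction n) (auto dest: commutators_mono[of _ _ X Y])

lemma derived_commutators_mono:
  "X \<subseteq> Y \<Longrightarrow> derived_commutators G X n \<subseteq> derived_commutators G Y n"
  by (induction n) (auto dest: commutators_mono)

lemma derived_commutators_add:
  "derived_commutators G X (m + n) = derived_commutators G (derived_commutators G X m) n"
  by (induction n) auto

context group
begin

lemma conj_closed_carrier: "conj_closed G X \<Longrightarrow> X \<subseteq> carrier G"
  by (simp add: conj_closed_def)

lemma conj_closed_generate_normal: "conj_closed G X \<Longrightarrow> generate G X \<lhd> G"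
  unfolding conj_closed_def by (intro normal_generateI) auto

lemma normal_conj_closed: "N \<lhd> G \<Longrightarrow> conj_closed G N"
  using normal_inv_iff subgroup.subset unfolding conj_closed_def by blast

lemma generate_normal: "N \<lhd> G \<Longrightarrow> generate G N = N"
  by (meson generate_subgroup_incl generate.incl normal_imp_subgroup order_refl subsetI subset_antisym)

lemma conj_closed_Un: "conj_closed G X \<Longrightarrow> conj_closed G Y \<Longrightarrow> conj_closed G (X \<union> Y)"
  unfolding conj_closed_def by blast

lemma conj_commutator:
  assumes "h \<in> carrier G" "k \<in> carrier G" "g \<in> carrier G"
  shows "g \<otimes> (h \<otimes> k \<otimes> inv h \<otimes> inv k) \<otimes> inv g =
    (g \<otimes> h \<otimes> inv g) \<otimes> (g \<otimes> k \<otimes> inv g) \<otimes> inv (g \<otimes> h \<otimes> inv g) \<otimes> inv (g \<otimes> k \<otimes> inv g)"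
proof -
  have cancel: "inv g \<otimes> (g \<otimes> x) = x" if "x \<in> carrier G" for x
    using that assms by (simp flip: m_assoc)
  show ?thesis using assms by (simp add: m_assoc inv_mult_group cancel)
qed

lemma conj_closed_commutators:
  assumes X: "conj_closed G X" and Y: "conj_closed G Y"
  shows "conj_closed G (commutators G X Y)"
  unfolding conj_closed_def
proof (intro conjI ballI)
  show "commutators G X Y \<subseteq> carrier G"
    using conj_closed_carrier[OF X] conj_closed_carrier[OF Y]
    by (auto elim!: commutatorsE simp: subset_iff)
  fix c g assume c: "c \<in> commutators G X Y" and g: "g \<in> carrier G"
  from c obtain h k where hk: "h \<in> X" "k \<in> Y" "c = h \<otimes> k \<otimes> inv h \<otimes> inv k"
    by (rule commutatorsE)
  then have "h \<in> carrier G" "k \<in> carrier G"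
    using conj_closed_carrier[OF X] conj_closed_carrier[OF Y] by auto
  then show "g \<otimes> c \<otimes> inv g \<in> commutators G X Y"
    using hk X Y g unfolding conj_closed_def
    by (auto simp: conj_commutator intro!: commutatorsI)
qed

lemma conj_closed_left_commutators:
  "conj_closed G X \<Longrightarrow> conj_closed G (left_commutators G X n)"
  by (induction n) (auto intro: conj_closed_commutators)

lemma conj_closed_derived_commutators:
  "conj_closed G X \<Longrightarrow> conj_closed G (derived_commutators G X n)"
  by (induction n) (auto intro: conj_closed_commutators)

text \<open>With \<open>commutator_inv_left\<close>, this shows that for normal \<open>N\<close> the
  elements whose commutator with \<open>k\<close> lies in \<open>N\<close> form a subgroup.\<close>

lemma commutator_mult_left:
  assumes "a \<in> carrier G" "b \<in> carrier G" "k \<in> carrier G"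
  shows "(a \<otimes> b) \<otimes> k \<otimes> inv (a \<otimes> b) \<otimes> inv k =
    (a \<otimes> (b \<otimes> k \<otimes> inv b \<otimes> inv k) \<otimes> inv a) \<otimes> (a \<otimes> k \<otimes> inv a \<otimes> inv k)"
proof -
  have 1: "inv a \<otimes> (a \<otimes> x) = x" if "x \<in> carrier G" for x
    using that assms by (simp flip: m_assoc)
  have 2: "inv k \<otimes> (k \<otimes> x) = x" if "x \<in> carrier G" for x
    using that assms by (simp flip: m_assoc)
  show ?thesis using assms by (simp add: m_assoc inv_mult_group 1 2)
qed

lemma inv_commutator:
  assumes "h \<in> carrier G" "k \<in> carrier G"
  shows "inv (h \<otimes> k \<otimes> inv h \<otimes> inv k) = k \<otimes> h \<otimes> inv k \<otimes> inv h"
  using assms by (simp add: m_assoc inv_mult_group)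

lemma commutator_inv_left:
  assumes "a \<in> carrier G" "k \<in> carrier G"
  shows "inv a \<otimes> k \<otimes> inv (inv a) \<otimes> inv k =
    inv a \<otimes> inv (a \<otimes> k \<otimes> inv a \<otimes> inv k) \<otimes> inv (inv a)"
proof -
  have 1: "inv a \<otimes> (a \<otimes> x) = x" if "x \<in> carrier G" for x
    using that assms by (simp flip: m_assoc)
  show ?thesis using assms by (simp add: inv_commutator) (simp add: m_assoc)
qed

text \<open>Modulo \<open>N\<close>, the hypothesis says that \<open>X\<close> centralizes
  \<open>k\<close>; centralizers are subgroups, so \<open>generate G X\<close> centralizes
  \<open>k\<close> too.\<close>

lemma commutator_generate_left:
  assumes N: "N \<lhd> G" and X: "X \<subseteq> carrier G" and k: "k \<in> carrier G"
    and *: "\<And>h. h \<in> X \<Longrightarrow> h \<otimes> k \<otimes> inv h \<otimes> inv k \<in> N"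
    and h: "h \<in> generate G X"
  shows "h \<otimes> k \<otimes> inv h \<otimes> inv k \<in> N"
proof -
  interpret N: normal N G by (rule N)
  show ?thesis using h
  proof (induction rule: generate.induct)
    case one
    then show ?case using k by simp
  next
    case (incl h)
    then show ?case by (rule *)
  next
    case (inv h)
    then have "h \<in> carrier G" using X by blast
    then show ?case using *[OF inv] k
      by (metis N.inv_op_closed2 N.m_inv_closed commutator_inv_left inv_closed)
  next
    case (eng a b)
    then have "a \<in> carrier G" "b \<in> carrier G" using X generate_incl by blast+
    then show ?case using eng.IH k by (simp only: commutator_mult_left N.m_closed N.inv_op_closed2)
  qed
qed

text \<open>One argument at a time: first \<open>h\<close> runs over \<open>generate G X\<close>
  against a fixed \<open>y\<close> in \<open>Y\<close>, then \<open>k\<close> over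
  \<open>generate G Y\<close> against the fixed \<open>h\<close>. Inverting a commutator swaps its
  arguments, so the one-sided lemma serves both passes.\<close>

lemma commutator_generate:
  assumes N: "N \<lhd> G" and X: "X \<subseteq> carrier G" and Y: "Y \<subseteq> carrier G"
    and *: "commutators G X Y \<subseteq> N"
    and h: "h \<in> generate G X" and k: "k \<in> generate G Y"
  shows "h \<otimes> k \<otimes> inv h \<otimes> inv k \<in> N"
proof -
  interpret N: normal N G by (rule N)
  have hc: "h \<in> carrier G" and kc: "k \<in> carrier G"
    using h k X Y generate_incl by blast+
  have "y \<otimes> h \<otimes> inv y \<otimes> inv h \<in> N" if "y \<in> Y" for y
  proof -
    have yc: "y \<in> carrier G" using that Y by blast
    have "x \<otimes> y \<otimes> inv x \<otimes> inv y \<in> N" if "x \<in> X" for x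
      using * commutatorsI[OF that \<open>y \<in> Y\<close>] by (rule subsetD)
    then have "h \<otimes> y \<otimes> inv h \<otimes> inv y \<in> N"
      by (intro commutator_generate_left[OF N X yc _ h])
    from N.m_inv_closed[OF this] show ?thesis by (simp only: inv_commutator[OF hc yc])
  qed
  then have "k \<otimes> h \<otimes> inv k \<otimes> inv h \<in> N"
    by (intro commutator_generate_left[OF N Y hc _ k])
  from N.m_inv_closed[OF this] show ?thesis by (simp only: inv_commutator[OF kc hc])
qed

text \<open>Conjugation-closure makes the right-hand side normal, which is what
  \<open>commutator_generate\<close> requires of its target.\<close>

lemma commutator_subgroup_generate:
  assumes X: "conj_closed G X" and Y: "conj_closed G Y"
  shows "commutator_subgroup G (generate G X) (generate G Y) = generate G (commutators G X Y)"
proof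
  let ?N = "generate G (commutators G X Y)"
  have N: "?N \<lhd> G"
    by (intro conj_closed_generate_normal conj_closed_commutators X Y)
  have "commutators G (generate G X) (generate G Y) \<subseteq> ?N"
    using commutator_generate[OF N conj_closed_carrier[OF X] conj_closed_carrier[OF Y]]
    by (auto elim!: commutatorsE simp: generate.incl subset_iff)
  then show "commutator_subgroup G (generate G X) (generate G Y) \<subseteq> ?N"
    unfolding commutator_subgroup_commutators
    by (rule generate_subgroup_incl[OF _ normal_imp_subgroup[OF N]])
  show "?N \<subseteq> commutator_subgroup G (generate G X) (generate G Y)"
    unfolding commutator_subgroup_commutators
    by (intro mono_generate commutators_mono) (auto intro: generate.incl)
qed

text \<open>Class and derived length of a subgroup are computed in the structure with restricted
  carrier; this moves the computation into \<open>G\<close>.\<close>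

lemma commutator_subgroup_consistent:
  assumes "H \<subseteq> K" "H' \<subseteq> K" "subgroup K G"
  shows "commutator_subgroup (G\<lparr>carrier := K\<rparr>) H H' = commutator_subgroup G H H'"
proof -
  have eq: "commutators (G\<lparr>carrier := K\<rparr>) H H' = commutators G H H'"
    using m_inv_consistent[OF assms(3)] assms(1,2) unfolding commutators_def
    by (auto simp: subset_iff) metis+
  have "commutators G H H' \<subseteq> K"
    using assms subgroup.m_closed[OF assms(3)] subgroup.m_inv_closed[OF assms(3)]
    by (auto elim!: commutatorsE simp: subset_iff)
  then show ?thesis
    by (simp add: commutator_subgroup_commutators eq generate_consistent[OF _ assms(3)])
qed

lemma generate_commutators_subset:
  assumes "subgroup K G" "generate G X \<subseteq> K" "generate G Y \<subseteq> K"
  shows "generate G (commutators G X Y) \<subseteq> K"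
proof (rule generate_subgroup_incl[OF _ assms(1)])
  have "X \<subseteq> K" "Y \<subseteq> K" using assms generate.incl[of _ _ G] by blast+
  then show "commutators G X Y \<subseteq> K"
    using subgroup.m_closed[OF assms(1)] subgroup.m_inv_closed[OF assms(1)]
    by (auto elim!: commutatorsE simp: subset_iff)
qed

section \<open>Lower central and derived series in terms of generators\<close>

lemma lower_central_generate:
  assumes X: "conj_closed G X"
  shows "lower_central (G\<lparr>carrier := generate G X\<rparr>) n = generate G (left_commutators G X n)"
proof -
  have sub: "subgroup (generate G X) G"
    using conj_closed_carrier[OF X] by (rule generate_is_subgroup)
  \<comment> \<open>The inclusion is carried along in the induction because
    \<open>commutator_subgroup_consistent\<close> needs each term to lie inside the restricted
    carrier.\<close>
  have "generate G (left_commutators G X n) \<subseteq> generate G X \<and> ?thesis"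
  proof (induction n)
    case 0
    then show ?case by simp
  next
    case (Suc n)
    then show ?case
      using generate_commutators_subset[OF sub] conj_closed_left_commutators[OF X, of n] X
      by (simp add: commutator_subgroup_consistent[OF _ _ sub] commutator_subgroup_generate)
  qed
  then show ?thesis ..
qed

lemma derived_series_generate:
  assumes X: "conj_closed G X"
  shows "(derived (G\<lparr>carrier := generate G X\<rparr>) ^^ n) (generate G X) =
    generate G (derived_commutators G X n)"
proof -
  have sub: "subgroup (generate G X) G"
    using conj_closed_carrier[OF X] by (rule generate_is_subgroup)
  have "generate G (derived_commutators G X n) \<subseteq> generate G X \<and> ?thesis"
  proof (induction n)
    case 0
    then show ?case by simp
  next
    case (Suc n)
    then show ?case
      using generate_commutators_subset[OF sub] conj_closed_derived_commutators[OF X, of n]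
      by (simp add: derived_commutator_subgroup commutator_subgroup_consistent[OF _ _ sub]
          commutator_subgroup_generate)
  qed
  then show ?thesis ..
qed

lemma generate_trivial_iff: "generate G X = {\<one>} \<longleftrightarrow> X \<subseteq> {\<one>}"
proof
  assume "generate G X = {\<one>}"
  then show "X \<subseteq> {\<one>}" using generate.incl[of _ X G] by blast
next
  assume "X \<subseteq> {\<one>}"
  then have "generate G X \<subseteq> {\<one>}" using mono_generate generate_one by metis
  then show "generate G X = {\<one>}" using generate.one[of G X] by blast
qed

text \<open>A subgroup is trivial as soon as its generators are, so the class bound turns into a
  condition on commutators of generators, without \<open>generate\<close>.\<close>

lemma nilpotent_class_le_generate:
  "conj_closed G X \<Longrightarrow>
    nilpotent_class_le (G\<lparr>carrier := generate G X\<rparr>) d \<longleftrightarrow> left_commutators G X d \<subseteq> {\<one>}"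
  by (simp add: nilpotent_class_le_def lower_central_generate generate_trivial_iff)

lemma derived_length_le_generate:
  "conj_closed G X \<Longrightarrow>
    derived_length_le (G\<lparr>carrier := generate G X\<rparr>) d \<longleftrightarrow> derived_commutators G X d \<subseteq> {\<one>}"
  by (simp add: derived_length_le_def derived_series_generate generate_trivial_iff)

lemma nilpotent_class_le_normal:
  "N \<lhd> G \<Longrightarrow> nilpotent_class_le (G\<lparr>carrier := N\<rparr>) d \<longleftrightarrow> left_commutators G N d \<subseteq> {\<one>}"
  using nilpotent_class_le_generate[OF normal_conj_closed] by (simp add: generate_normal)

lemma derived_length_le_normal:
  "N \<lhd> G \<Longrightarrow> derived_length_le (G\<lparr>carrier := N\<rparr>) d \<longleftrightarrow> derived_commutators G N d \<subseteq> {\<one>}"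
  using derived_length_le_generate[OF normal_conj_closed] by (simp add: generate_normal)

lemma commutators_one_left:
  "X \<subseteq> {\<one>} \<Longrightarrow> Y \<subseteq> carrier G \<Longrightarrow> commutators G X Y \<subseteq> {\<one>}"
  by (auto elim!: commutatorsE simp: subset_iff)

lemma left_commutators_trivial_mono:
  assumes "X \<subseteq> carrier G" "c \<le> d" "left_commutators G X c \<subseteq> {\<one>}"
  shows "left_commutators G X d \<subseteq> {\<one>}"
  using assms(2,3) by (induction rule: dec_induct) (auto dest!: commutators_one_left[OF _ assms(1)])

lemma derived_commutators_trivial_mono:
  assumes "c \<le> d" "derived_commutators G X c \<subseteq> {\<one>}"
  shows "derived_commutators G X d \<subseteq> {\<one>}"
  using assms
proof (induction rule: dec_induct)
  case (step n)
  then have 1: "derived_commutators G X n \<subseteq> {\<one>}" by blast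
  then have "derived_commutators G X n \<subseteq> carrier G" by auto
  from commutators_one_left[OF 1 this] show ?case by simp
qed

lemma commutator_in_normal:
  assumes N: "N \<lhd> G" and ab: "a \<in> carrier G" "b \<in> carrier G" "a \<in> N \<or> b \<in> N"
  shows "a \<otimes> b \<otimes> inv a \<otimes> inv b \<in> N"
proof -
  interpret N: normal N G by (rule N)
  show ?thesis
  proof (cases "a \<in> N")
    case True
    \<comment> \<open>Rebracketed, the commutator is \<open>a\<close> times a conjugate of
      \<open>inv a\<close>.\<close>
    have "a \<otimes> (b \<otimes> inv a \<otimes> inv b) \<in> N"
      using True ab by (intro N.m_closed N.inv_op_closed2 N.m_inv_closed)
    then show ?thesis using ab by (simp add: m_assoc)
  next
    case False
    then show ?thesis using ab by (intro N.m_closed N.inv_op_closed2 N.m_inv_closed) auto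
  qed
qed

section \<open>Joins of normal subgroups\<close>

text \<open>Fitting's argument: a left-normed commutator of \<open>n + 1\<close> elements, \<open>p\<close> of them from \<open>M\<close> and
  \<open>q\<close> from \<open>N\<close>, lies in the terms of weight \<open>p\<close> and \<open>q\<close> of the two lower central series.
  Weight \<open>0\<close> has to be the whole group, since then no entry from the subgroup occurs.\<close>

definition weighted_term :: "'a set \<Rightarrow> nat \<Rightarrow> 'a set" where
  "weighted_term N p = (case p of 0 \<Rightarrow> carrier G | Suc q \<Rightarrow> generate G (left_commutators G N q))"

lemma weighted_term_normal: "N \<lhd> G \<Longrightarrow> weighted_term N p \<lhd> G"
  by (simp add: weighted_term_def normal_self conj_closed_generate_normal
      conj_closed_left_commutators normal_conj_closed split: nat.split)

lemma weighted_term_Suc: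
  assumes N: "N \<lhd> G" and a: "a \<in> weighted_term N p" and b: "b \<in> N"
  shows "a \<otimes> b \<otimes> inv a \<otimes> inv b \<in> weighted_term N (Suc p)"
proof (cases p)
  case 0
  have "b \<in> carrier G" using b normal_conj_closed[OF N] conj_closed_carrier by blast
  then show ?thesis using a b N 0 commutator_in_normal[OF N]
    by (simp add: weighted_term_def generate_normal)
next
  case (Suc q)
  have "a \<otimes> b \<otimes> inv a \<otimes> inv b \<in>
      commutator_subgroup G (generate G (left_commutators G N q)) (generate G N)"
    using a b Suc generate.incl[of b N G] unfolding commutator_subgroup_commutators
    by (intro generate.incl[of _ "commutators _ _ _"] commutatorsI) (auto simp: weighted_term_def)
  also have "\<dots> = weighted_term N (Suc p)"
    using normal_conj_closed[OF N]
    by (simp add: Suc weighted_term_def commutator_subgroup_generate conj_closed_left_commutators)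
  finally show ?thesis .
qed

text \<open>A new entry from \<open>M\<close> raises the weight in \<open>M\<close> by one, and an
  entry outside \<open>M\<close> raises the weight in \<open>N\<close>. The other weight is kept
  because its term is normal.\<close>

lemma left_commutators_Un_weighted:
  assumes M: "M \<lhd> G" and N: "N \<lhd> G" and a: "a \<in> left_commutators G (M \<union> N) n"
  shows "\<exists>p q. p + q = Suc n \<and> a \<in> weighted_term M p \<and> a \<in> weighted_term N q"
  using a
proof (induction n arbitrary: a)
  case 0
  then have a: "a \<in> M \<union> N" by simp
  then have ac: "a \<in> carrier G"
    using M N normal_conj_closed conj_closed_carrier by blast
  show ?case
  proof (cases "a \<in> M")
    case True
    then show ?thesis using ac M
      by (intro exI[of _ 1] exI[of _ 0]) (simp add: weighted_term_def generate_normal)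
  next
    case False
    then show ?thesis using ac a N
      by (intro exI[of _ 0] exI[of _ 1]) (simp add: weighted_term_def generate_normal)
  qed
next
  case (Suc n)
  from Suc.prems obtain c b where c: "c \<in> left_commutators G (M \<union> N) n" and b: "b \<in> M \<union> N"
    and a: "a = c \<otimes> b \<otimes> inv c \<otimes> inv b"
    unfolding left_commutators.simps(2) by (rule commutatorsE)
  obtain p q where pq: "p + q = Suc n" "c \<in> weighted_term M p" "c \<in> weighted_term N q"
    using Suc.IH[OF c] by blast
  have bc: "b \<in> carrier G" using b M N normal_conj_closed conj_closed_carrier by blast
  have cc: "c \<in> carrier G"
    using pq(2) normal_conj_closed[OF weighted_term_normal[OF M]] conj_closed_carrier by blast
  have aM: "a \<in> weighted_term M p" and aN: "a \<in> weighted_term N q"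
    unfolding a using pq bc cc M N by (auto intro!: commutator_in_normal weighted_term_normal)
  show ?case
  proof (cases "b \<in> M")
    case True
    then have "a \<in> weighted_term M (Suc p)" unfolding a using M pq by (intro weighted_term_Suc)
    then show ?thesis using aN pq(1) by (intro exI[of _ "Suc p"] exI[of _ q]) simp
  next
    case False
    then have "a \<in> weighted_term N (Suc q)" unfolding a using N pq b by (intro weighted_term_Suc) auto
    then show ?thesis using aM pq(1) by (intro exI[of _ p] exI[of _ "Suc q"]) simp
  qed
qed

text \<open>Weight \<open>p > 0\<close> is the usual \<open>p\<close>-th lower central term, index
  \<open>p - 1\<close> in the shifted count, so class at most \<open>d\<close> kills the weights
  above \<open>d\<close>.\<close>

lemma weighted_term_trivial:
  assumes N: "N \<lhd> G" and "nilpotent_class_le (G\<lparr>carrier := N\<rparr>) d" and "d < p"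
  shows "weighted_term N p = {\<one>}"
proof -
  obtain q where q: "p = Suc q" "d \<le> q" using assms(3) by (cases p) auto
  have "left_commutators G N q \<subseteq> {\<one>}"
    using left_commutators_trivial_mono[OF conj_closed_carrier[OF normal_conj_closed[OF N]] q(2)]
      assms by (simp add: nilpotent_class_le_normal)
  then show ?thesis by (simp add: q weighted_term_def generate_trivial_iff)
qed

theorem nilpotent_class_le_join:
  assumes M: "M \<lhd> G" and N: "N \<lhd> G"
    and c: "nilpotent_class_le (G\<lparr>carrier := M\<rparr>) c" and d: "nilpotent_class_le (G\<lparr>carrier := N\<rparr>) d"
  shows "nilpotent_class_le (G\<lparr>carrier := generate G (M \<union> N)\<rparr>) (c + d)"
proof -
  have "a = \<one>" if a: "a \<in> left_commutators G (M \<union> N) (c + d)" for a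
  proof -
    obtain p q where pq: "p + q = Suc (c + d)" "a \<in> weighted_term M p" "a \<in> weighted_term N q"
      using left_commutators_Un_weighted[OF M N a] by blast
    \<comment> \<open>Weights adding up to \<open>c + d + 1\<close> cannot satisfy both
      \<open>p <= c\<close> and \<open>q <= d\<close>.\<close>
    then consider "c < p" | "d < q" by linarith
    then show ?thesis
      using pq weighted_term_trivial[OF M c, of p] weighted_term_trivial[OF N d, of q] by cases auto
  qed
  then show ?thesis
    using M N by (auto simp: nilpotent_class_le_generate normal_conj_closed conj_closed_Un)
qed

text \<open>Modulo \<open>N\<close> the join is an image of \<open>M\<close>, so after
  \<open>c\<close> steps the derived commutators lie in \<open>N\<close>, and \<open>d\<close>
  further steps kill them.\<close>

theorem derived_length_le_join:
  assumes M: "M \<lhd> G" and N: "N \<lhd> G"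
    and c: "derived_length_le (G\<lparr>carrier := M\<rparr>) c" and d: "derived_length_le (G\<lparr>carrier := N\<rparr>) d"
  shows "derived_length_le (G\<lparr>carrier := generate G (M \<union> N)\<rparr>) (c + d)"
proof -
  \<comment> \<open>A commutator with an entry in \<open>N\<close> falls into \<open>N\<close> by
    normality; otherwise both entries are derived commutators of \<open>M\<close>.\<close>
  have D: "derived_commutators G (M \<union> N) n \<subseteq> derived_commutators G M n \<union> N" for n
  proof (induction n)
    case 0
    then show ?case by simp
  next
    case (Suc n)
    show ?case
    proof
      fix a assume "a \<in> derived_commutators G (M \<union> N) (Suc n)"
      then obtain h k where h: "h \<in> derived_commutators G (M \<union> N) n"
        and k: "k \<in> derived_commutators G (M \<union> N) n" and a: "a = h \<otimes> k \<otimes> inv h \<otimes> inv k"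
        unfolding derived_commutators.simps(2) by (rule commutatorsE)
      have "derived_commutators G (M \<union> N) n \<subseteq> carrier G"
        by (intro conj_closed_carrier conj_closed_derived_commutators conj_closed_Un
            normal_conj_closed M N)
      then have "h \<in> carrier G" "k \<in> carrier G" using h k by blast+
      then have "a \<in> N" if "h \<in> N \<or> k \<in> N"
        unfolding a using that by (intro commutator_in_normal N)
      moreover have "a \<in> derived_commutators G M (Suc n)" if "\<not> (h \<in> N \<or> k \<in> N)"
        unfolding a using that h k Suc by (auto intro: commutatorsI)
      ultimately show "a \<in> derived_commutators G M (Suc n) \<union> N" by blast
    qed
  qed
  have "\<one> \<in> N" using normal_imp_subgroup[OF N] by (rule subgroup.one_closed)
  then have "derived_commutators G (M \<union> N) c \<subseteq> N"
    using D[of c] c M by (auto simp: derived_length_le_normal)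
  from derived_commutators_mono[OF this, of G d]
  have "derived_commutators G (M \<union> N) (c + d) \<subseteq> {\<one>}"
    using d N by (auto simp: derived_commutators_add derived_length_le_normal)
  then show ?thesis
    using M N by (simp add: derived_length_le_generate normal_conj_closed conj_closed_Un)
qed

section \<open>Definability of bounds on normal closures\<close>

lemma normal_closure_subset: "N \<lhd> G \<Longrightarrow> A \<subseteq> N \<Longrightarrow> normal_closure G A \<subseteq> N"
  unfolding normal_closure_def by blast

lemma normal_closure_incl: "A \<subseteq> normal_closure G A"
  unfolding normal_closure_def by blast

definition conjugates :: "'a set \<Rightarrow> 'a set" where
  "conjugates A = {g \<otimes> a \<otimes> inv g | g a. g \<in> carrier G \<and> a \<in> A}"

lemma conj_closed_conjugates:
  assumes "A \<subseteq> carrier G"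
  shows "conj_closed G (conjugates A)"
  unfolding conj_closed_def
proof (intro conjI ballI)
  show "conjugates A \<subseteq> carrier G" using assms unfolding conjugates_def by auto
  fix x h assume "x \<in> conjugates A" and h: "h \<in> carrier G"
  then obtain g a where *: "g \<in> carrier G" "a \<in> A" "x = g \<otimes> a \<otimes> inv g"
    unfolding conjugates_def by blast
  then have "a \<in> carrier G" using assms by blast
  then have "h \<otimes> x \<otimes> inv h = (h \<otimes> g) \<otimes> a \<otimes> inv (h \<otimes> g)"
    using * h by (simp add: m_assoc inv_mult_group)
  then show "h \<otimes> x \<otimes> inv h \<in> conjugates A"
    using * h unfolding conjugates_def by blast
qed

text \<open>Presents the normal closure by a conjugation-closed generating set, so that the
  commutator criteria above apply to it.\<close>

lemma normal_closure_generate: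
  assumes A: "A \<subseteq> carrier G"
  shows "normal_closure G A = generate G (conjugates A)"
proof
  have "A \<subseteq> conjugates A"
  proof
    fix a assume "a \<in> A"
    moreover from this have "a = \<one> \<otimes> a \<otimes> inv \<one>" using A by auto
    ultimately show "a \<in> conjugates A" unfolding conjugates_def by blast
  qed
  then show "normal_closure G A \<subseteq> generate G (conjugates A)"
    using generate.incl[of _ _ G]
    by (intro normal_closure_subset conj_closed_generate_normal conj_closed_conjugates A) blast
  have "generate G (conjugates A) \<subseteq> N" if N: "N \<lhd> G" and "A \<subseteq> N" for N
  proof (rule generate_subgroup_incl[OF _ normal_imp_subgroup[OF N]])
    show "conjugates A \<subseteq> N"
      using that normal_inv_iff unfolding conjugates_def by blast
  qed
  then show "generate G (conjugates A) \<subseteq> normal_closure G A"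
    unfolding normal_closure_def by blast
qed

lemma normal_closure_normal: "A \<subseteq> carrier G \<Longrightarrow> normal_closure G A \<lhd> G"
  by (simp add: normal_closure_generate conj_closed_generate_normal conj_closed_conjugates)

lemma normal_join: "M \<lhd> G \<Longrightarrow> N \<lhd> G \<Longrightarrow> generate G (M \<union> N) \<lhd> G"
  by (intro conj_closed_generate_normal conj_closed_Un normal_conj_closed)

text \<open>\<open>F k\<close> says that \<open>Var k\<close> lies in \<open>S (Var 0)\<close>.  Having one formula for every \<open>k > 0\<close> allows
  nested constructions to bind only variables above \<open>k\<close>, so that no renaming is ever needed.\<close>

definition defines_family :: "(nat \<Rightarrow> 'a gform) \<Rightarrow> ('a \<Rightarrow> 'a set) \<Rightarrow> bool" where
  "defines_family F S \<longleftrightarrow> (\<forall>k>0. free_vars (F k) \<subseteq> {0, k} \<and> params (F k) = {} \<and>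
     (\<forall>e. e 0 \<in> carrier G \<longrightarrow> sat G e (F k) = (e k \<in> S (e 0))))"

definition definable_family :: "('a \<Rightarrow> 'a set) \<Rightarrow> bool" where
  "definable_family S \<longleftrightarrow> (\<exists>F. defines_family F S)"

lemma defines_familyD:
  assumes "defines_family F S" and "k > 0"
  shows "free_vars (F k) \<subseteq> {0, k}" "params (F k) = {}"
    "e 0 \<in> carrier G \<Longrightarrow> sat G e (F k) = (e k \<in> S (e 0))"
  using assms unfolding defines_family_def by simp_all

lemma definable_family_conjugates: "definable_family (\<lambda>x. conjugates {x})"
  unfolding definable_family_def defines_family_def
proof (intro exI allI impI conjI)
  let ?F = "\<lambda>k. Ex (Suc k) (Eq (Var k) (Mult (Mult (Var (Suc k)) (Var 0)) (Inv (Var (Suc k)))))"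
  fix k :: nat assume k: "k > 0"
  show "free_vars (?F k) \<subseteq> {0, k}" by auto
  show "params (?F k) = {}" by simp
  fix e :: "nat \<Rightarrow> 'a"
  show "sat G e (?F k) = (e k \<in> conjugates {e 0})"
    using k by (auto simp: conjugates_def)
qed

text \<open>\<open>Ex\<close> ranges over \<open>carrier G\<close> only; \<open>Sc\<close> and
  \<open>Tc\<close> ensure that this captures all members of \<open>S x\<close> and
  \<open>T x\<close>.\<close>

lemma definable_family_commutators:
  assumes S: "definable_family S" and T: "definable_family T"
    and Sc: "\<And>x. x \<in> carrier G \<Longrightarrow> S x \<subseteq> carrier G"
    and Tc: "\<And>x. x \<in> carrier G \<Longrightarrow> T x \<subseteq> carrier G"
  shows "definable_family (\<lambda>x. commutators G (S x) (T x))"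
proof -
  obtain F where "defines_family F S" using S unfolding definable_family_def by (rule exE)
  note F = defines_familyD[OF this]
  obtain H where "defines_family H T" using T unfolding definable_family_def by (rule exE)
  note H = defines_familyD[OF this]
  let ?C = "\<lambda>k. Eq (Var k) (Mult (Mult (Mult (Var (k + 1)) (Var (k + 2))) (Inv (Var (k + 1))))
    (Inv (Var (k + 2))))"
  \<comment> \<open>The two entries are the values of \<open>Var (k + 1)\<close> and
    \<open>Var (k + 2)\<close>. Binding these leaves \<open>Var 0\<close> and \<open>Var k\<close>
    untouched, and \<open>F (k + 1)\<close> does not depend on \<open>Var (k + 2)\<close>.\<close>
  let ?F = "\<lambda>k. Ex (k + 1) (Ex (k + 2) (And (?C k) (And (F (k + 1)) (H (k + 2)))))"
  show ?thesis
    unfolding definable_family_def defines_family_def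
  proof (intro exI allI impI conjI)
    fix k :: nat assume k: "k > 0"
    show "free_vars (?F k) \<subseteq> {0, k}" using F(1)[of "k + 1"] H(1)[of "k + 2"] by auto
    show "params (?F k) = {}" using F(2)[of "k + 1"] H(2)[of "k + 2"] by auto
    fix e :: "nat \<Rightarrow> 'a" assume e: "e 0 \<in> carrier G"
    show "sat G e (?F k) = (e k \<in> commutators G (S (e 0)) (T (e 0)))"
      using k e Sc[OF e] Tc[OF e] by (auto simp: F H commutators_def)
  qed
qed

lemma conjugates_subset: "x \<in> carrier G \<Longrightarrow> conjugates {x} \<subseteq> carrier G"
  by (auto simp: conjugates_def)

lemma left_commutators_conjugates_subset:
  "x \<in> carrier G \<Longrightarrow> left_commutators G (conjugates {x}) n \<subseteq> carrier G"
  by (simp add: conj_closed_carrier conj_closed_left_commutators conj_closed_conjugates)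

lemma derived_commutators_conjugates_subset:
  "x \<in> carrier G \<Longrightarrow> derived_commutators G (conjugates {x}) n \<subseteq> carrier G"
  by (simp add: conj_closed_carrier conj_closed_derived_commutators conj_closed_conjugates)

lemma definable_family_left_commutators:
  "definable_family (\<lambda>x. left_commutators G (conjugates {x}) n)"
proof (induction n)
  case 0
  then show ?case by (simp add: definable_family_conjugates)
next
  case (Suc n)
  then show ?case
    by (simp add: definable_family_commutators definable_family_conjugates conjugates_subset
        left_commutators_conjugates_subset)
qed

lemma definable_family_derived_commutators:
  "definable_family (\<lambda>x. derived_commutators G (conjugates {x}) n)"
proof (induction n)
  case 0
  then show ?case by (simp add: definable_family_conjugates)
next
  case (Suc n)
  then show ?case
    by (simp add: definable_family_commutators derived_commutators_conjugates_subset)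
qed

lemma definable_family_trivial:
  assumes "definable_family S" and "\<And>x. x \<in> carrier G \<Longrightarrow> S x \<subseteq> carrier G"
  shows "\<exists>\<phi>. free_vars \<phi> \<subseteq> {0} \<and> params \<phi> = {} \<and>
    (\<forall>e. e 0 \<in> carrier G \<longrightarrow> sat G e \<phi> = (S (e 0) \<subseteq> {\<one>}))"
proof -
  obtain F where "defines_family F S" using assms(1) unfolding definable_family_def by (rule exE)
  note F = defines_familyD[OF this zero_less_one]
  \<comment> \<open>No member of \<open>S (Var 0)\<close> differs from the neutral element.\<close>
  let ?\<phi> = "Neg (Ex 1 (And (F 1) (Neg (Eq (Var 1) Neutral))))"
  have "free_vars ?\<phi> \<subseteq> {0}" "params ?\<phi> = {}" using F by auto
  moreover have "sat G e ?\<phi> = (S (e 0) \<subseteq> {\<one>})" if "e 0 \<in> carrier G" for e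
    using that assms(2)[OF that] by (auto simp: F(3)[unfolded One_nat_def])
  ultimately show ?thesis by blast
qed

end

section \<open>Radicals of normal subgroups of bounded length\<close>

text \<open>Collects the properties shared by nilpotency class and derived length, so that both
  equivalences follow from one argument. Here \<open>len_le d N\<close> reads: \<open>N\<close> has
  length at most \<open>d\<close>.\<close>

locale normal_length = group G for G :: "('a, 'b) monoid_scheme" (structure) +
  fixes len_le :: "nat \<Rightarrow> 'a set \<Rightarrow> bool"
  assumes len_le_one: "len_le 0 {\<one>}"
    and len_le_mono: "N \<lhd> G \<Longrightarrow> len_le c N \<Longrightarrow> c \<le> d \<Longrightarrow> len_le d N"
    and len_le_subset: "N \<lhd> G \<Longrightarrow> len_le d N \<Longrightarrow> M \<lhd> G \<Longrightarrow> M \<subseteq> N \<Longrightarrow> len_le d M"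
    and len_le_join: "M \<lhd> G \<Longrightarrow> N \<lhd> G \<Longrightarrow> len_le c M \<Longrightarrow> len_le d N \<Longrightarrow>
      len_le (c + d) (generate G (M \<union> N))"
    and len_le_definable: "\<exists>\<phi>. free_vars \<phi> \<subseteq> {0} \<and> params \<phi> = {} \<and>
      (\<forall>e. e 0 \<in> carrier G \<longrightarrow> sat G e \<phi> = len_le d (normal_closure G {e 0}))"
begin

definition radical :: "'a set" where
  "radical = generate G (\<Union>{N. N \<lhd> G \<and> (\<exists>d. len_le d N)})"

definition level :: "nat \<Rightarrow> 'a set" where
  "level d = {x \<in> carrier G. len_le d (normal_closure G {x})}"

lemma level_mono: "c \<le> d \<Longrightarrow> level c \<subseteq> level d"
  unfolding level_def using len_le_mono normal_closure_normal by auto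

lemma normal_subset_level:
  assumes N: "N \<lhd> G" and d: "len_le d N"
  shows "N \<subseteq> level d"
proof
  fix x assume x: "x \<in> N"
  then have "x \<in> carrier G" using conj_closed_carrier[OF normal_conj_closed[OF N]] by blast
  moreover from this x have "len_le d (normal_closure G {x})"
    by (intro len_le_subset[OF N d] normal_closure_normal normal_closure_subset[OF N]) auto
  ultimately show "x \<in> level d" by (simp add: level_def)
qed

lemma level_subset_radical: "level d \<subseteq> radical"
proof
  fix x assume "x \<in> level d"
  then have "normal_closure G {x} \<lhd> G" "len_le d (normal_closure G {x})"
    by (auto simp: level_def normal_closure_normal)
  then show "x \<in> radical" unfolding radical_def
    using normal_closure_incl[of "{x}"] by (intro generate.incl) blast
qed

text \<open>The union of the levels is closed under products because the join of two normal
  subgroups of bounded length has bounded length.\<close>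

lemma radical_level: "radical = (\<Union>d. level d)"
proof
  show "radical \<subseteq> (\<Union>d. level d)"
  proof
    fix x assume "x \<in> radical"
    then show "x \<in> (\<Union>d. level d)" unfolding radical_def
    proof (induction rule: generate.induct)
      case one
      show ?case using normal_subset_level[OF one_is_normal len_le_one] by blast
    next
      case (incl h)
      then show ?case using normal_subset_level by blast
    next
      case (inv h)
      then obtain N d where N: "N \<lhd> G" "len_le d N" "h \<in> N" by blast
      then have "inv h \<in> N" using subgroup.m_inv_closed normal_imp_subgroup by metis
      then show ?case using normal_subset_level[OF N(1,2)] by blast
    next
      case (eng a b)
      then obtain c d where a: "a \<in> level c" and b: "b \<in> level d" by blast
      let ?A = "normal_closure G {a}" and ?B = "normal_closure G {b}"
      have A: "?A \<lhd> G" "len_le c ?A" and B: "?B \<lhd> G" "len_le d ?B"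
        using a b by (auto simp: level_def normal_closure_normal)
      have "a \<otimes> b \<in> generate G (?A \<union> ?B)"
        using normal_closure_incl[of "{a}"] normal_closure_incl[of "{b}"]
        by (intro generate.eng generate.incl) auto
      then show ?case
        using normal_subset_level[OF normal_join[OF A(1) B(1)] len_le_join[OF A(1) B(1) A(2) B(2)]]
        by blast
    qed
  qed
  show "(\<Union>d. level d) \<subseteq> radical" using level_subset_radical by blast
qed

lemma radical_subset_carrier: "radical \<subseteq> carrier G"
  by (auto simp: radical_level level_def)

lemma level_formula:
  "\<exists>\<phi>. free_vars \<phi> \<subseteq> {0} \<and> params \<phi> = {} \<and>
    (\<forall>e. e 0 \<in> carrier G \<longrightarrow> sat G e \<phi> = (e 0 \<in> level d))"
  using len_le_definable[of d] by (simp add: level_def)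

lemma definable_level: "definable G (level d)"
proof -
  obtain \<phi> where "free_vars \<phi> \<subseteq> {0}" "params \<phi> = {}"
    "\<And>e. e 0 \<in> carrier G \<Longrightarrow> sat G e \<phi> = (e 0 \<in> level d)"
    using level_formula[of d] by blast
  then show ?thesis unfolding definable_def formulas_over_def
    by (intro bexI[of _ \<phi>]) (auto simp: level_def)
qed

text \<open>If the levels never exhausted the radical, the conditions of lying in the radical and
  outside every level would be finitely satisfiable. By saturation some element would meet them all,
  contradicting \<open>radical_level\<close>.\<close>

lemma definable_radical_eq_level:
  assumes "aleph0_saturated G" and "definable G radical"
  shows "\<exists>d. radical = level d"
proof (rule ccontr)
  assume neq: "\<nexists>d. radical = level d"
  obtain \<phi> where \<phi>: "free_vars \<phi> \<subseteq> {0}" "params \<phi> \<subseteq> carrier G"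
    and rad: "radical = {a \<in> carrier G. sat G (\<lambda>_. a) \<phi>}"
    using assms(2) unfolding definable_def formulas_over_def by auto
  \<comment> \<open>\<open>definable\<close> evaluates under a constant assignment; since only
    \<open>Var 0\<close> can be free, any assignment with the same value at 0 gives the same
    result.\<close>
  have sat_\<phi>: "sat G e \<phi> = (e 0 \<in> radical)" if "e 0 \<in> carrier G" for e
    using that \<phi>(1) sat_cong[of \<phi> e "\<lambda>_. e 0" G] unfolding rad by auto
  have "\<exists>\<psi>. \<forall>d. free_vars (\<psi> d) \<subseteq> {0} \<and> params (\<psi> d) = {} \<and>
      (\<forall>e. e 0 \<in> carrier G \<longrightarrow> sat G e (\<psi> d) = (e 0 \<in> level d))"
    by (intro choice allI level_formula)
  then obtain \<psi> where \<psi>: "\<And>d. free_vars (\<psi> d) \<subseteq> {0}" "\<And>d. params (\<psi> d) = {}"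
    "\<And>d e. e 0 \<in> carrier G \<Longrightarrow> sat G e (\<psi> d) = (e 0 \<in> level d)" by blast
  let ?p = "insert \<phi> (range (\<lambda>d. Neg (\<psi> d)))"
  have "finitely_satisfiable G 1 ?p"
    unfolding finitely_satisfiable_def
  proof (intro allI impI)
    fix q assume q: "q \<subseteq> ?p" "finite q"
    then have "q - {\<phi>} \<subseteq> (\<lambda>d. Neg (\<psi> d)) ` UNIV" "finite (q - {\<phi>})" by auto
    then obtain D where D: "finite D" "q - {\<phi>} = (\<lambda>d. Neg (\<psi> d)) ` D"
      using finite_subset_image[of "q - {\<phi>}" "\<lambda>d. Neg (\<psi> d)" UNIV] by blast
    obtain m where m: "\<forall>d\<in>D. d \<le> m"
      using D(1) unfolding finite_nat_set_iff_bounded_le by (rule exE)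
    \<comment> \<open>Levels increase, so an element outside \<open>level m\<close> avoids all the
      levels occurring in \<open>q\<close>.\<close>
    obtain x where x: "x \<in> radical" "x \<notin> level m"
      using neq level_subset_radical[of m] by blast
    then have xc: "x \<in> carrier G" using radical_subset_carrier by blast
    have "sat G (\<lambda>_. x) \<theta>" if "\<theta> \<in> q" for \<theta>
    proof (cases "\<theta> = \<phi>")
      case True
      then show ?thesis using x xc sat_\<phi> by simp
    next
      case False
      then have "\<theta> \<in> (\<lambda>d. Neg (\<psi> d)) ` D" using that D(2) by blast
      then obtain d where d: "d \<in> D" "\<theta> = Neg (\<psi> d)" by (rule imageE)
      then have "x \<notin> level d" using x(2) m level_mono[of d m] by blast
      then show ?thesis using d xc \<psi>(3) by simp
    qed
    then show "\<exists>e. realizes G 1 e q" using xc unfolding realizes_def by (intro exI[of _ "\<lambda>_. x"]) auto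
  qed
  \<comment> \<open>The level formulas have no parameters, so the partial type is over the finitely
    many parameters of \<open>\<phi>\<close>, as saturation demands.\<close>
  moreover have "finite (params \<phi>)" by (rule gform.set_finite)
  moreover have "?p \<subseteq> formulas_over (params \<phi>) 1"
    using \<phi>(1) subsetD[OF \<psi>(1)] \<psi>(2) by (auto simp: formulas_over_def)
  ultimately obtain e where "realizes G 1 e ?p"
    using aleph0_saturated_realizes[OF assms(1) _ \<phi>(2)] by blast
  then have "e 0 \<in> carrier G" "sat G e \<phi>" "\<And>d. \<not> sat G e (\<psi> d)"
    unfolding realizes_def by auto
  then show False using sat_\<phi> \<psi>(3) radical_level by blast
qed

text \<open>The closure of \<open>insert x A\<close> lies in the join of the closures of
  \<open>{x}\<close> and of \<open>A\<close>, so each element adds at most \<open>d\<close> to the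
  length, starting from 0 for the trivial subgroup.\<close>

lemma len_le_normal_closure:
  assumes "finite A" "A \<subseteq> level d"
  shows "len_le (card A * d) (normal_closure G A)"
  using assms
proof (induction rule: finite_induct)
  case empty
  have "normal_closure G {} = {\<one>}"
    by (simp add: normal_closure_generate conjugates_def generate_empty)
  then show ?case by (simp add: len_le_one)
next
  case (insert x A)
  have x: "x \<in> carrier G" "len_le d (normal_closure G {x})" and A: "A \<subseteq> carrier G"
    using insert.prems by (auto simp: level_def)
  have n: "normal_closure G {x} \<lhd> G" "normal_closure G A \<lhd> G" "normal_closure G (insert x A) \<lhd> G"
    using x A by (auto intro: normal_closure_normal)
  have "len_le (d + card A * d) (generate G (normal_closure G {x} \<union> normal_closure G A))"
    using insert x by (intro len_le_join n) auto
  moreover have "normal_closure G (insert x A) \<subseteq>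
      generate G (normal_closure G {x} \<union> normal_closure G A)"
    using normal_closure_incl[of "{x}"] normal_closure_incl[of A]
    by (intro normal_closure_subset normal_join n) (auto intro: generate.incl)
  ultimately have "len_le (d + card A * d) (normal_closure G (insert x A))"
    using len_le_subset n normal_join by blast
  then show ?case using insert.hyps by simp
qed

theorem definable_radical_iff:
  assumes "aleph0_saturated G"
  shows "definable G radical \<longleftrightarrow>
    (\<forall>m>0. \<exists>d. \<forall>A. finite A \<and> card A \<le> m \<and> A \<subseteq> radical \<longrightarrow> len_le d (normal_closure G A))"
proof
  assume "definable G radical"
  from definable_radical_eq_level[OF assms this] obtain d where d: "radical = level d" ..
  have "len_le (m * d) (normal_closure G A)"
    if "finite A \<and> card A \<le> m \<and> A \<subseteq> radical" for m A
  proof -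
    have "normal_closure G A \<lhd> G"
      using that radical_subset_carrier by (intro normal_closure_normal) blast
    moreover have "len_le (card A * d) (normal_closure G A)"
      using that d by (intro len_le_normal_closure) auto
    ultimately show ?thesis by (rule len_le_mono) (use that in simp)
  qed
  then show "\<forall>m>0. \<exists>d. \<forall>A. finite A \<and> card A \<le> m \<and> A \<subseteq> radical \<longrightarrow>
    len_le d (normal_closure G A)" by blast
next
  assume "\<forall>m>0. \<exists>d. \<forall>A. finite A \<and> card A \<le> m \<and> A \<subseteq> radical \<longrightarrow>
    len_le d (normal_closure G A)"
  then obtain d where d: "\<And>A. finite A \<and> card A \<le> 1 \<and> A \<subseteq> radical \<Longrightarrow>
    len_le d (normal_closure G A)" by (meson zero_less_one)
  \<comment> \<open>The bound for \<open>m = 1\<close> is applied to the singletons of elements of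
    the radical.\<close>
  have "radical \<subseteq> level d"
    using d[of "{_}"] radical_subset_carrier by (auto simp: level_def)
  then have "radical = level d" using level_subset_radical by blast
  then show "definable G radical" using definable_level by simp
qed

end

section \<open>The two instances: nilpotency class and derived length\<close>

context group
begin

lemma normal_length_nilpotent: "normal_length G (\<lambda>d N. nilpotent_class_le (G\<lparr>carrier := N\<rparr>) d)"
proof (unfold_locales, goal_cases)
  case 1
  then show ?case by (simp add: nilpotent_class_le_def)
next
  case (2 N c d)
  then show ?case
    using left_commutators_trivial_mono[OF conj_closed_carrier[OF normal_conj_closed]]
    by (simp add: nilpotent_class_le_normal)
next
  case (3 N d M)
  then show ?case using left_commutators_mono[of M N G d] by (simp add: nilpotent_class_le_normal)
next
  case (4 M N c d)
  then show ?case by (rule nilpotent_class_le_join)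
next
  case (5 d)
  \<comment> \<open>The normal closure of \<open>x\<close> is generated by its conjugates, so its
    class is at most \<open>d\<close> exactly when their left-normed commutators of index
    \<open>d\<close> are trivial.\<close>
  from definable_family_trivial[OF definable_family_left_commutators left_commutators_conjugates_subset]
  show ?case
    by (simp add: normal_closure_generate nilpotent_class_le_generate conj_closed_conjugates)
qed

lemma normal_length_derived: "normal_length G (\<lambda>d N. derived_length_le (G\<lparr>carrier := N\<rparr>) d)"
proof (unfold_locales, goal_cases)
  case 1
  then show ?case by (simp add: derived_length_le_def)
next
  case (2 N c d)
  then show ?case
    using derived_commutators_trivial_mono by (simp add: derived_length_le_normal)
next
  case (3 N d M)
  then show ?case using derived_commutators_mono[of M N G d] by (simp add: derived_length_le_normal)
next
  case (4 M N c d)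
  then show ?case by (rule derived_length_le_join)
next
  case (5 d)
  from definable_family_trivial[OF definable_family_derived_commutators derived_commutators_conjugates_subset]
  show ?case
    by (simp add: normal_closure_generate derived_length_le_generate conj_closed_conjugates)
qed

text \<open>Connects \<open>solvable\<close>, used to define the soluble radical, with derived
  length, which measures it in \<open>normal_length\<close>.\<close>

lemma solvable_normal_iff:
  assumes "N \<lhd> G"
  shows "solvable (G\<lparr>carrier := N\<rparr>) \<longleftrightarrow> (\<exists>d. derived_length_le (G\<lparr>carrier := N\<rparr>) d)"
  using group.solvable_iff_trivial_derived_seq[OF subgroup_imp_group[OF normal_imp_subgroup[OF assms]]]
  by (simp add: derived_length_le_def)

end

theorem theorem1p3:
  fixes G :: "('a, 'b) monoid_scheme"
  assumes "group G" and "aleph0_saturated G"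
  shows "(definable G (fitting G) \<longleftrightarrow> fitting_uniformly_normally_locally_nilpotent G) \<and>
         (definable G (soluble_radical G) \<longleftrightarrow> radical_uniformly_normally_locally_soluble G)"
proof -
  interpret group G by (rule assms(1))
  interpret nil: normal_length G "\<lambda>d N. nilpotent_class_le (G\<lparr>carrier := N\<rparr>) d"
    by (rule normal_length_nilpotent)
  interpret sol: normal_length G "\<lambda>d N. derived_length_le (G\<lparr>carrier := N\<rparr>) d"
    by (rule normal_length_derived)
  have "fitting G = nil.radical"
    by (simp add: fitting_def nil.radical_def nilpotent_def)
  moreover have "soluble_radical G = sol.radical"
    unfolding soluble_radical_def sol.radical_def using solvable_normal_iff by metis
  ultimately show ?thesis
    using nil.definable_radical_iff[OF assms(2)] sol.definable_radical_iff[OF assms(2)]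
    by (simp add: fitting_uniformly_normally_locally_nilpotent_def
        radical_uniformly_normally_locally_soluble_def)
qed

end
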